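(* Let $d,r\ge 1$ be integers, let $n=(d+1)(r-1)+1$, let $a_1,\ldots,a_r$ be integers with $a_i\le d+1$ for all $i$ and $\sum_{i=1}^r a_i=n$, and let $X\subset\mathbb{R}^d$ be a set obtained from these data by the construction described in the context. Then $X$ has exactly $[(r-1)!]^d$ different Tverberg partitions.
   Context: Construction of $X$. Let $e^1,\ldots,e^d$ be the standard basis of $\mathbb{R}^d$. For $1\le j\le d$ let $A_j=\{e^j,2e^j,\ldots,(r-1)e^j\}$. Since $\sum_{i=1}^r(d+1-a_i)=d$, one can choose for each $1\le j\le d$ an index $i(j)\in\{1,\ldots,r\}$ so that for all $1\le i\le r$, $\#\{1\le j\le d: i(j)=i\}=d+1-a_i$; fix any such choice. For $1\le i\le r$ and $1\le j\le d$ let $x^i_j=0$ if $i=i(j)$ and $x^i_j=-i$ otherwise, let $x^i=(x^i_1,\ldots,x^i_d)\in\mathbb{R}^d$, and let $A=\{x^1,\ldots,x^r\}$. Set $X=A\cup A_1\cup\cdots\cup A_d$; this is a disjoint union with $|A|=r$, $|A_j|=r-1$, so $|X|=n$. A Tverberg partition of $X$ is a partition of $X$ into $r$ pairwise disjoint subsets $X_1,\ldots,X_r$ (with union $X$) such that $\bigcap_{i=1}^r \mathrm{conv}(X_i)\neq\emptyset$, where $\mathrm{conv}$ denotes convex hull. When counting Tverberg partitions, partitions are unordered: two partitions differing only in the numbering of their parts are the same. *)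

theory Defs
  imports "HOL-Analysis.Analysis" "HOL-Library.Disjoint_Sets"
begin

text \<open>
  The space is \<open>real ^ 'd\<close>, so the dimension is \<open>CARD('d)\<close> and the coordinates are indexed by the
  elements of \<open>'d\<close> instead of the numbers \<open>1, \<dots>, d\<close>; the construction does not use an ordering of
  the coordinates. The upper index \<open>i\<close> (of \<open>a\<^sub>i\<close>, \<open>x\<^sup>i\<close>) ranges over \<open>{1..r}\<close>.
\<close>

definition admissible_choice :: "nat \<Rightarrow> (nat \<Rightarrow> int) \<Rightarrow> ('d::finite \<Rightarrow> nat) \<Rightarrow> bool" where
  "admissible_choice r a c \<longleftrightarrow>
     (\<forall>j. c j \<in> {1..r}) \<and>
     (\<forall>i\<in>{1..r}. int (card {j. c j = i}) = int CARD('d) + 1 - a i)"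

definition axis_points :: "nat \<Rightarrow> 'd::finite \<Rightarrow> (real ^ 'd) set" where
  "axis_points r j = (\<lambda>k. real k *\<^sub>R axis j 1) ` {1..r - 1}"

definition choice_point :: "('d::finite \<Rightarrow> nat) \<Rightarrow> nat \<Rightarrow> real ^ 'd" where
  "choice_point c i = (\<chi> j. if i = c j then 0 else - real i)"

definition constructed_set :: "nat \<Rightarrow> ('d::finite \<Rightarrow> nat) \<Rightarrow> (real ^ 'd) set" where
  "constructed_set r c = choice_point c ` {1..r} \<union> (\<Union>j. axis_points r j)"

text \<open>
  A partition is the set of its parts, hence unordered. \<^const>\<open>partition_on\<close> excludes empty parts;
  this loses nothing, because the convex hull of an empty part is empty.
\<close>

definition tverberg_partition :: "nat \<Rightarrow> (real ^ 'd::finite) set \<Rightarrow> (real ^ 'd) set set \<Rightarrow> bool" where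
  "tverberg_partition r X P \<longleftrightarrow>
     partition_on X P \<and> card P = r \<and> (\<Inter>Y\<in>P. convex hull Y) \<noteq> {}"

end

theory Submission
  imports Defs
begin

text \<open>
  In coordinate \<open>j\<close> exactly \<open>r - 1\<close> points of \<open>X\<close> are positive (those of \<open>A\<^sub>j\<close>) and exactly \<open>r - 1\<close>
  are negative (the \<open>x\<^sup>i\<close> with \<open>i \<noteq> i(j)\<close>), so a point common to \<open>r\<close> hulls of disjoint parts has
  to be the origin. A part whose hull contains the origin needs some \<open>x\<^sup>i\<close>, so every part has
  exactly one, and the part of \<open>x\<^sup>i\<close> needs a point of \<open>A\<^sub>j\<close> to compensate \<open>x\<^sup>i\<^sub>j < 0\<close> whenever
  \<open>i \<noteq> i(j)\<close>. Since \<open>A\<^sub>j\<close> has only \<open>r - 1\<close> points, a Tverberg partition amounts to a bijection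
  from \<open>A\<^sub>j\<close> to the indices \<open>i \<noteq> i(j)\<close>, chosen independently for each \<open>j\<close>.
\<close>

section \<open>Disjoint families and convex hulls\<close>

text \<open>Disjointness makes any choice of one point of \<open>B\<close> per part injective. This
  bounds the number of parts once each part needs a point of a scarce kind.\<close>

lemma card_le_transversal:
  assumes "disjoint P" "finite B" "\<And>Y. Y \<in> P \<Longrightarrow> Y \<inter> B \<noteq> {}"
  shows "card P \<le> card B"
proof -
  have "\<forall>Y\<in>P. \<exists>y. y \<in> Y \<inter> B" using assms(3) by auto
  then obtain f where f: "\<And>Y. Y \<in> P \<Longrightarrow> f Y \<in> Y \<inter> B" by metis
  have "inj_on f P"
    using f assms(1) by (intro inj_onI) (metis IntD1 disjointD disjoint_iff)
  moreover have "f ` P \<subseteq> B" using f by auto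
  ultimately show ?thesis using assms(2) by (simp add: card_inj_on_le)
qed

text \<open>Without such a \<open>y\<close>, the set \<open>Y\<close> would lie in a closed
  half-space, which is convex and so contains the hull as well.\<close>

lemma convex_hull_inner_greater:
  assumes "p \<in> convex hull Y" "b < inner l p"
  obtains y where "y \<in> Y" "b < inner l y"
proof -
  have "\<exists>y\<in>Y. b < inner l y"
  proof (rule ccontr)
    assume "\<not> ?thesis"
    then have "Y \<subseteq> {x. inner l x \<le> b}" by (auto simp: not_less)
    then have "convex hull Y \<subseteq> {x. inner l x \<le> b}"
      by (rule hull_minimal) (rule convex_halfspace_le)
    then show False using assms by auto
  qed
  then show ?thesis using that by blast
qed

lemma convex_hull_inner_le:
  assumes "p \<in> convex hull Y" "inner l p \<le> b"
  obtains y where "y \<in> Y" "inner l y \<le> b"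
proof -
  have "\<exists>y\<in>Y. inner l y \<le> b"
  proof (rule ccontr)
    assume "\<not> ?thesis"
    then have "Y \<subseteq> {x. b < inner l x}" by (auto simp: not_le)
    then have "convex hull Y \<subseteq> {x. b < inner l x}"
      by (rule hull_minimal) (rule convex_halfspace_gt)
    then show False using assms by auto
  qed
  then show ?thesis using that by blast
qed

text \<open>Dividing by the total weight \<open>T\<close> turns the relation into a convex
  combination that is still 0, so weights can be used unnormalized later.\<close>

lemma convex_zero_combination:
  assumes "convex C" "finite I" "x \<in> C" "\<And>i. i \<in> I \<Longrightarrow> y i \<in> C" "\<And>i. i \<in> I \<Longrightarrow> 0 \<le> t i"
    and "x + (\<Sum>i\<in>I. t i *\<^sub>R y i) = 0"
  shows "0 \<in> C"
proof -
  define T where "T = 1 + sum t I"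
  have T: "T > 0" using sum_nonneg[of I t] assms(5) by (simp add: T_def)
  \<comment> \<open>The index \<open>None\<close> stands for the extra point \<open>x\<close>, so
    that all points enter one sum over an option type.\<close>
  let ?w = "case_option (1 / T) (\<lambda>i. t i / T)" and ?z = "case_option x y"
  let ?J = "insert None (Some ` I)"
  have S: "sum f ?J = f None + (\<Sum>i\<in>I. f (Some i))" for f :: "_ \<Rightarrow> 'z::comm_monoid_add"
    using assms(2) by (simp add: sum.reindex)
  have "(\<Sum>i\<in>?J. ?w i *\<^sub>R ?z i) \<in> C"
  proof (rule convex_sum)
    have "1 / T + sum t I / T = 1" using T by (simp add: T_def flip: add_divide_distrib)
    then show "sum ?w ?J = 1" unfolding S by (simp add: sum_divide_distrib)
  qed (use assms T in auto)
  also have "(\<Sum>i\<in>?J. ?w i *\<^sub>R ?z i) = (1 / T) *\<^sub>R (x + (\<Sum>i\<in>I. t i *\<^sub>R y i))"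
    unfolding S by (simp add: scaleR_right_distrib scaleR_sum_right)
  finally show ?thesis using assms(6) by simp
qed

section \<open>Coordinates and distinctness of the points\<close>

lemma choice_point_nth: "choice_point c i $ j = (if i = c j then 0 else - real i)"
  by (simp add: choice_point_def)

lemma axis_multiple_nth: "(s *\<^sub>R axis j 1) $ k = (if k = j then s else (0::real))"
  by (simp add: axis_def)

lemma choice_point_inj:
  assumes "i \<ge> 1" "m \<ge> 1" "choice_point c i = choice_point c m"
  shows "i = m"
proof -
  \<comment> \<open>One coordinate suffices: it is 0 exactly for the index \<open>c j\<close>, and
    every other positive index is read off from its nonzero value.\<close>
  fix j :: 'a
  have "choice_point c i $ j = choice_point c m $ j" using assms(3) by simp
  then show ?thesis using assms(1,2) by (auto simp: choice_point_nth split: if_splits)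
qed

lemma axis_multiple_inj:
  fixes j k :: "'d::finite"
  assumes "s \<noteq> 0" "s *\<^sub>R axis j 1 = (t *\<^sub>R axis k 1 :: real ^ 'd)"
  shows "j = k \<and> s = t"
proof -
  have "(s *\<^sub>R axis j 1) $ j = (t *\<^sub>R axis k 1 :: real ^ 'd) $ j" using assms(2) by simp
  then show ?thesis using assms(1) unfolding axis_multiple_nth by (auto split: if_splits)
qed

lemma choice_point_neq_axis_multiple:
  assumes "s > 0"
  shows "choice_point c i \<noteq> s *\<^sub>R axis j 1"
proof
  assume "choice_point c i = s *\<^sub>R axis j 1"
  then have "choice_point c i $ j = (s *\<^sub>R axis j 1) $ j" by simp
  then show False using assms unfolding axis_multiple_nth
    by (auto simp: choice_point_nth split: if_splits)
qed

lemma constructed_set_cases: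
  assumes "y \<in> constructed_set r c"
  obtains (choice) i where "i \<in> {1..r}" "y = choice_point c i"
    | (axis) j k where "k \<in> {1..r - 1}" "y = real k *\<^sub>R axis j 1"
  using assms by (auto simp: constructed_set_def axis_points_def)

lemma choice_point_mem: "i \<in> {1..r} \<Longrightarrow> choice_point c i \<in> constructed_set r c"
  by (auto simp: constructed_set_def)

lemma axis_multiple_mem: "k \<in> {1..r - 1} \<Longrightarrow> real k *\<^sub>R axis j 1 \<in> constructed_set r c"
  unfolding constructed_set_def axis_points_def by blast

section \<open>Constraints on an arbitrary Tverberg partition\<close>

lemma tverberg_point_zero:
  fixes c :: "'d::finite \<Rightarrow> nat"
  assumes "r \<ge> 1" and c: "range c \<subseteq> {1..r}"
    and P: "disjoint P" "card P = r" and sub: "\<And>Y. Y \<in> P \<Longrightarrow> Y \<subseteq> constructed_set r c"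
    and p: "\<And>Y. Y \<in> P \<Longrightarrow> p \<in> convex hull Y"
  shows "p = 0"
proof (rule vec_eq_iff[THEN iffD2], rule allI, rule ccontr)
  fix j assume "p $ j \<noteq> 0 $ j"
  then consider "p $ j > 0" | "p $ j < 0" by fastforce
  then show False
  proof cases
    case 1
    have "card P \<le> card ((\<lambda>k. real k *\<^sub>R axis j 1 :: real ^ 'd) ` {1..r - 1})"
    proof (rule card_le_transversal[OF P(1)])
      fix Y assume Y: "Y \<in> P"
      obtain y where y: "y \<in> Y" "0 < inner (axis j 1) y"
        using convex_hull_inner_greater[OF p[OF Y], of 0 "axis j 1"] 1 by (auto simp: inner_axis')
      then have yj: "y $ j > 0" by (simp add: inner_axis')
      have "y \<in> constructed_set r c" using y Y sub by auto
      then have "y \<in> (\<lambda>k. real k *\<^sub>R axis j 1) ` {1..r - 1}"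
      proof (cases rule: constructed_set_cases)
        case (choice i) then show ?thesis using yj by (auto simp: choice_point_nth split: if_splits)
      next
        case (axis l k)
        have "j = l" using yj unfolding axis(2) axis_multiple_nth by (auto split: if_splits)
        then show ?thesis using axis by auto
      qed
      then show "Y \<inter> (\<lambda>k. real k *\<^sub>R axis j 1) ` {1..r - 1} \<noteq> {}" using y by blast
    qed simp
    also have "\<dots> \<le> r - 1" by (rule card_image_le[THEN order_trans]) auto
    finally show False using P(2) assms(1) by simp
  next
    case 2
    have "card P \<le> card (choice_point c ` ({1..r} - {c j}))"
    proof (rule card_le_transversal[OF P(1)])
      fix Y assume Y: "Y \<in> P"
      \<comment> \<open>Negating the axis vector lets the same half-space lemma produce a point with
        negative coordinate \<open>j\<close>.\<close>
      obtain y where y: "y \<in> Y" "0 < inner (- axis j 1) y"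
        using convex_hull_inner_greater[OF p[OF Y], of 0 "- axis j 1"] 2 by (auto simp: inner_axis')
      then have yj: "y $ j < 0" by (simp add: inner_axis')
      have "y \<in> constructed_set r c" using y Y sub by auto
      then have "y \<in> choice_point c ` ({1..r} - {c j})"
      proof (cases rule: constructed_set_cases)
        case (choice i) then show ?thesis using yj by (auto simp: choice_point_nth split: if_splits)
      next
        case (axis l k)
        then show ?thesis using yj unfolding axis(2) axis_multiple_nth by (auto split: if_splits)
      qed
      then show "Y \<inter> choice_point c ` ({1..r} - {c j}) \<noteq> {}" using y by blast
    qed simp
    also have "\<dots> \<le> card ({1..r} - {c j})" by (rule card_image_le) auto
    also have "\<dots> = r - 1" using c by (simp add: card_Diff_singleton_if image_subset_iff)
    finally show False using P(2) assms(1) by simp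
  qed
qed

lemma zero_hull_choice_point:
  fixes c :: "'d::finite \<Rightarrow> nat"
  assumes "Y \<subseteq> constructed_set r c" "0 \<in> convex hull Y"
  shows "\<exists>i\<in>{1..r}. choice_point c i \<in> Y"
proof -
  \<comment> \<open>The inner product with the constant vector 1 is the coordinate sum. It is
    positive on every axis point, so \<open>y\<close> can only be a choice point.\<close>
  obtain y where y: "y \<in> Y" "inner 1 y \<le> 0"
    using convex_hull_inner_le[OF assms(2), of 1 0] by auto
  have "y \<in> constructed_set r c" using y assms by auto
  then show ?thesis
  proof (cases rule: constructed_set_cases)
    case (axis j k)
    then have "inner 1 y = real k" by (simp add: inner_axis)
    then show ?thesis using axis y by auto
  qed (use y in auto)
qed

text \<open>By \<open>only\<close>, no choice point other than \<open>x\<^sup>i\<close> lies in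
  \<open>Y\<close>. A functional positive at \<open>x\<^sup>i\<close> and off
  \<open>A\<^sub>j\<close> thus forces a point of \<open>A\<^sub>j\<close> into
  \<open>Y\<close>.\<close>

lemma zero_hull_axis_point:
  fixes c :: "'d::finite \<Rightarrow> nat"
  assumes "Y \<subseteq> constructed_set r c" "0 \<in> convex hull Y" "i \<noteq> c j" "i \<ge> 1"
    and only: "\<And>m. m \<in> {1..r} \<Longrightarrow> choice_point c m \<in> Y \<Longrightarrow> m = i"
  shows "\<exists>k\<in>{1..r - 1}. real k *\<^sub>R axis j 1 \<in> Y"
proof -
  \<comment> \<open>this functional is positive at \<open>x\<^sup>i\<close> and on all axis points outside \<open>A\<^sub>j\<close>\<close>
  define l :: "real ^ 'd" where "l = 1 - (real CARD('d) + 1) *\<^sub>R axis j 1"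
  have l: "inner l y = (\<Sum>k\<in>UNIV. y $ k) - (real CARD('d) + 1) * y $ j" for y
    by (simp add: l_def inner_diff_left inner_axis' inner_vec_def[of 1])
  obtain y where y: "y \<in> Y" "inner l y \<le> 0"
    using convex_hull_inner_le[OF assms(2), of l 0] by auto
  have "y \<in> constructed_set r c" using y assms by auto
  then show ?thesis
  proof (cases rule: constructed_set_cases)
    case (choice m)
    then have m: "y = choice_point c i" using only y by auto
    \<comment> \<open>With \<open>d = CARD('d)\<close>, the coordinate sum is at least
      \<open>-d * i\<close>, while coordinate \<open>j\<close> contributes
      \<open>(d + 1) * i\<close>. The factor \<open>d + 1\<close> in \<open>l\<close> thus leaves a
      surplus of at least \<open>i\<close>.\<close>
    have "(\<Sum>k\<in>(UNIV::'d set). - real i) \<le> (\<Sum>k\<in>UNIV. y $ k)"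
      by (intro sum_mono) (simp add: m choice_point_nth)
    then have "- (real CARD('d) * real i) \<le> (\<Sum>k\<in>UNIV. y $ k)" by simp
    moreover have "y $ j = - real i" using assms(3) by (simp add: m choice_point_nth)
    ultimately have "real i \<le> inner l y" unfolding l by (simp add: algebra_simps)
    then show ?thesis using y assms(4) by simp
  next
    case (axis m k)
    have "inner l y = (if m = j then - real CARD('d) * real k else real k)"
      unfolding l axis(2) axis_multiple_nth by (simp add: algebra_simps)
    then show ?thesis using axis y by (auto split: if_splits)
  qed
qed

section \<open>Assignments and the partitions they induce\<close>

text \<open>Extensional functions make each assignment a unique object, so that counting is
  meaningful. Injectivity is the form that the counting lemma takes; bijectivity follows from equal
  cardinalities.\<close>

definition assignments :: "nat \<Rightarrow> ('d::finite \<Rightarrow> nat) \<Rightarrow> ('d \<Rightarrow> nat \<Rightarrow> nat) set" where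
  "assignments r c =
     (\<Pi>\<^sub>E j\<in>UNIV. {g \<in> {1..r - 1} \<rightarrow>\<^sub>E {1..r} - {c j}. inj_on g {1..r - 1}})"

definition assigned_part ::
  "nat \<Rightarrow> ('d::finite \<Rightarrow> nat) \<Rightarrow> ('d \<Rightarrow> nat \<Rightarrow> nat) \<Rightarrow> nat \<Rightarrow> (real ^ 'd) set" where
  "assigned_part r c g i =
     insert (choice_point c i) {real k *\<^sub>R axis j 1 | j k. k \<in> {1..r - 1} \<and> g j k = i}"

lemma card_assignments:
  fixes c :: "'d::finite \<Rightarrow> nat"
  assumes "range c \<subseteq> {1..r}"
  shows "card (assignments r c) = fact (r - 1) ^ CARD('d)"
proof -
  have "card {g \<in> {1..r - 1} \<rightarrow>\<^sub>E {1..r} - {c j}. inj_on g {1..r - 1}} = fact (r - 1)" for j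
    using assms
    by (subst card_inj_on_subset_funcset)
      (simp_all add: fact_prod_rev card_Diff_singleton_if image_subset_iff)
  then show ?thesis by (simp add: assignments_def card_PiE)
qed

text \<open>Both sides have \<open>r - 1\<close> elements, so injectivity forces surjectivity, which
  supplies each part with the axis points it needs.\<close>

lemma assignments_bij:
  assumes "range c \<subseteq> {1..r}" "g \<in> assignments r c"
  shows "bij_betw (g j) {1..r - 1} ({1..r} - {c j})"
proof -
  have g: "g j \<in> {1..r - 1} \<rightarrow> {1..r} - {c j}" "inj_on (g j) {1..r - 1}"
    using assms(2) by (auto simp: assignments_def PiE_iff)
  have "g j ` {1..r - 1} = {1..r} - {c j}"
    using g assms(1)
    by (intro card_subset_eq) (auto simp: card_image card_Diff_singleton_if image_subset_iff)
  then show ?thesis using g by (simp add: bij_betw_def)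
qed

text \<open>The choice point acts as a label: it recovers the index of a part from the bare
  set.\<close>

lemma choice_point_assigned_part:
  assumes "i \<ge> 1" "m \<ge> 1"
  shows "choice_point c i \<in> assigned_part r c g m \<longleftrightarrow> i = m"
proof
  assume "choice_point c i \<in> assigned_part r c g m"
  then consider "choice_point c i = choice_point c m"
    | j k where "k \<in> {1..r - 1}" "choice_point c i = real k *\<^sub>R axis j 1"
    unfolding assigned_part_def by blast
  then show "i = m"
  proof cases
    case 1 then show ?thesis using assms by (rule choice_point_inj[rotated 2])
  next
    case (2 j k) then show ?thesis using choice_point_neq_axis_multiple[of "real k" c i j] by simp
  qed
qed (simp add: assigned_part_def)

lemma axis_multiple_assigned_part:
  assumes "k \<in> {1..r - 1}"
  shows "real k *\<^sub>R axis j 1 \<in> assigned_part r c g m \<longleftrightarrow> g j k = m"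
proof -
  have "real k *\<^sub>R axis j 1 \<noteq> choice_point c m"
    using choice_point_neq_axis_multiple[of "real k" c m j] assms by auto
  moreover have "j = l \<and> k = s" if "real k *\<^sub>R axis j 1 = (real s *\<^sub>R axis l 1 :: real ^ 'a)" for l s
    using axis_multiple_inj[OF _ that] assms by simp
  ultimately show ?thesis using assms unfolding assigned_part_def by blast
qed

lemma inj_on_assigned_part: "inj_on (assigned_part r c g) {1..r}"
proof (rule inj_onI)
  fix i m assume "i \<in> {1..r}" "m \<in> {1..r}" "assigned_part r c g i = assigned_part r c g m"
  then show "i = m"
    using choice_point_assigned_part[of i i c r g] choice_point_assigned_part[of i m c r g] by auto
qed

text \<open>For each \<open>j\<close> with \<open>c j \<noteq> i\<close> the part contains some
  \<open>k j\<close> times the axis vector. The weight \<open>i / k j\<close> scales it to length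
  \<open>i\<close>, which cancels the coordinate \<open>-i\<close> of
  \<open>x\<^sup>i\<close>.\<close>

lemma zero_hull_assigned_part:
  fixes c :: "'d::finite \<Rightarrow> nat"
  assumes c: "range c \<subseteq> {1..r}" and g: "g \<in> assignments r c" and i: "i \<in> {1..r}"
  shows "0 \<in> convex hull (assigned_part r c g i)"
proof -
  have "\<exists>k\<in>{1..r - 1}. g j k = i" if "c j \<noteq> i" for j
  proof -
    have "i \<in> g j ` {1..r - 1}"
      unfolding bij_betw_imp_surj_on[OF assignments_bij[OF c g]] using i that by simp
    then show ?thesis by blast
  qed
  then obtain k where k: "\<And>j. c j \<noteq> i \<Longrightarrow> k j \<in> {1..r - 1} \<and> g j (k j) = i"
    by metis
  let ?H = "convex hull (assigned_part r c g i)" and ?I = "{j. c j \<noteq> i}"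
  show ?thesis
  proof (rule convex_zero_combination[where I = ?I and x = "choice_point c i"
        and t = "\<lambda>j. real i / real (k j)" and y = "\<lambda>j. real (k j) *\<^sub>R axis j 1"])
    have "(\<Sum>j\<in>?I. (real i / real (k j)) *\<^sub>R (real (k j) *\<^sub>R axis j 1)) =
        (\<Sum>j\<in>?I. real i *\<^sub>R axis j 1 :: real ^ 'd)"
    proof (rule sum.cong)
      fix j assume "j \<in> ?I"
      then have "real (k j) \<noteq> 0" using k[of j] by simp
      then show "(real i / real (k j)) *\<^sub>R (real (k j) *\<^sub>R axis j 1) = (real i *\<^sub>R axis j 1 :: real ^ 'd)"
        by simp
    qed simp
    moreover have "(\<Sum>j\<in>?I. real i *\<^sub>R axis j 1) $ m = (if c m = i then 0 else real i)" for m
      unfolding sum_component axis_multiple_nth by (subst sum.delta') auto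
    ultimately show "choice_point c i +
        (\<Sum>j\<in>?I. (real i / real (k j)) *\<^sub>R (real (k j) *\<^sub>R axis j 1)) = 0"
      by (simp only: vec_eq_iff vector_add_component) (simp add: choice_point_nth)
    show "real (k j) *\<^sub>R axis j 1 \<in> ?H" if "j \<in> ?I" for j
      using that k[of j] axis_multiple_assigned_part[of "k j" r j c g i] by (intro hull_inc) auto
    show "choice_point c i \<in> ?H" by (rule hull_inc) (simp add: assigned_part_def)
  qed simp_all
qed

lemma tverberg_partition_assigned_part:
  assumes r: "r \<ge> 1" and c: "range c \<subseteq> {1..r}" and g: "g \<in> assignments r c"
  shows "tverberg_partition r (constructed_set r c) (assigned_part r c g ` {1..r})"
  unfolding tverberg_partition_def
proof (intro conjI)
  have gr: "g j k \<in> {1..r}" if "k \<in> {1..r - 1}" for j k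
    using bij_betwE[OF assignments_bij[OF c g, of j]] that by blast
  have sub: "assigned_part r c g i \<subseteq> constructed_set r c" if "i \<in> {1..r}" for i
    using that by (auto simp: assigned_part_def intro!: choice_point_mem axis_multiple_mem)
  show "partition_on (constructed_set r c) (assigned_part r c g ` {1..r})"
  proof (rule partition_onI)
    show "\<Union> (assigned_part r c g ` {1..r}) = constructed_set r c"
    proof
      show "constructed_set r c \<subseteq> \<Union> (assigned_part r c g ` {1..r})"
      proof
        fix y assume "y \<in> constructed_set r c"
        then show "y \<in> \<Union> (assigned_part r c g ` {1..r})"
        proof (cases rule: constructed_set_cases)
          case (choice i) then show ?thesis by (auto simp: assigned_part_def)
        next
          case (axis j k)
          then have "y \<in> assigned_part r c g (g j k)" by (simp add: axis_multiple_assigned_part)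
          then show ?thesis using gr[OF axis(1)] by blast
        qed
      qed
    qed (use sub in blast)
    show "disjnt p q" if pq: "p \<in> assigned_part r c g ` {1..r}"
      "q \<in> assigned_part r c g ` {1..r}" "p \<noteq> q" for p q
    proof -
      obtain i m where im: "i \<in> {1..r}" "m \<in> {1..r}" "i \<noteq> m"
        "p = assigned_part r c g i" "q = assigned_part r c g m" using pq by blast
      \<comment> \<open>A common point would be a choice point with two labels or an axis point that
        \<open>g\<close> sends to two indices.\<close>
      have False if "y \<in> p" "y \<in> q" for y
      proof -
        have "y \<in> constructed_set r c" using that im sub by blast
        then show False
          by (cases rule: constructed_set_cases)
            (use that im in \<open>auto simp: choice_point_assigned_part axis_multiple_assigned_part\<close>)
      qed
      then show ?thesis by (auto simp: disjnt_iff)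
    qed
  qed (auto simp: assigned_part_def)
  show "card (assigned_part r c g ` {1..r}) = r"
    by (subst card_image[OF inj_on_assigned_part]) simp
  show "(\<Inter>Y\<in>assigned_part r c g ` {1..r}. convex hull Y) \<noteq> {}"
    using zero_hull_assigned_part[OF c g] by blast
qed

text \<open>Equal sets of parts agree index by index, since the choice points label them; the part
  containing an axis point then determines the value of the assignment there.\<close>

lemma inj_on_assignments:
  assumes c: "range c \<subseteq> {1..r}"
  shows "inj_on (\<lambda>g. assigned_part r c g ` {1..r}) (assignments r c)"
proof (rule inj_onI)
  fix g h assume gh: "g \<in> assignments r c" "h \<in> assignments r c"
    and eq: "assigned_part r c g ` {1..r} = assigned_part r c h ` {1..r}"
  have part: "assigned_part r c g i = assigned_part r c h i" if i: "i \<in> {1..r}" for i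
  proof -
    obtain m where m: "m \<in> {1..r}" "assigned_part r c g i = assigned_part r c h m"
      using eq i by blast
    have "choice_point c i \<in> assigned_part r c h m"
      using m(2) by (auto simp: assigned_part_def)
    then show ?thesis using m i choice_point_assigned_part[of i m c r h] by auto
  qed
  show "g = h"
  proof (intro ext)
    fix j k
    show "g j k = h j k"
    proof (cases "k \<in> {1..r - 1}")
      case True
      then have "g j k \<in> {1..r}"
        using bij_betwE[OF assignments_bij[OF c gh(1), of j]] by blast
      then show ?thesis
        using part True axis_multiple_assigned_part[OF True, of j c g "g j k"]
          axis_multiple_assigned_part[OF True, of j c h "g j k"] by auto
    next
      \<comment> \<open>Outside \<open>{1..r - 1}\<close> both functions are
        \<open>undefined\<close> by extensionality.\<close>
      case False
      then show ?thesis using gh by (auto simp: assignments_def PiE_iff extensional_def)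
    qed
  qed
qed

section \<open>Every Tverberg partition comes from an assignment\<close>

lemma tverberg_partition_assigned:
  fixes c :: "'d::finite \<Rightarrow> nat"
  assumes r: "r \<ge> 1" and c: "range c \<subseteq> {1..r}"
    and P: "tverberg_partition r (constructed_set r c) P"
  shows "P \<in> (\<lambda>g. assigned_part r c g ` {1..r}) ` assignments r c"
proof -
  let ?X = "constructed_set r c"
  have part: "partition_on ?X P" and card: "card P = r"
    using P by (auto simp: tverberg_partition_def)
  have disj: "disjoint P" and un: "\<Union>P = ?X" using part by (auto simp: partition_on_def)
  have sub: "Y \<subseteq> ?X" if "Y \<in> P" for Y using that un by blast
  have uniq: "Y = Z" if "Y \<in> P" "Z \<in> P" "y \<in> Y" "y \<in> Z" for y Y Z
    using that disj by (metis disjointD disjoint_iff)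
  obtain p where p: "\<And>Y. Y \<in> P \<Longrightarrow> p \<in> convex hull Y"
    using P by (auto simp: tverberg_partition_def)
  have zero: "0 \<in> convex hull Y" if "Y \<in> P" for Y
    using tverberg_point_zero[OF r c disj card sub p] p[OF that] by simp
  have "\<forall>Y\<in>P. \<exists>i\<in>{1..r}. choice_point c i \<in> Y"
    using zero_hull_choice_point[OF sub zero] by blast
  then obtain f where f: "\<And>Y. Y \<in> P \<Longrightarrow> f Y \<in> {1..r} \<and> choice_point c (f Y) \<in> Y" by metis
  \<comment> \<open>A choice point lies in only one part, so \<open>f\<close> is injective, and
    \<open>card P = r\<close> makes it onto \<open>{1..r}\<close>. Hence the parts can be indexed as
    \<open>Q i\<close>, each with \<open>x\<^sup>i\<close> as its only choice point.\<close>
  have f_inj: "inj_on f P" using f uniq by (intro inj_onI) metis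
  have f_im: "f ` P = {1..r}"
    using f card f_inj by (intro card_subset_eq) (auto simp: card_image)
  define Q where "Q = inv_into P f"
  have Q: "Q i \<in> P" "choice_point c i \<in> Q i" if "i \<in> {1..r}" for i
    using that f_im f[of "Q i"] inv_into_into[of i f P] f_inv_into_f[of i f P]
    unfolding Q_def by auto
  have QP: "Q ` {1..r} = P"
    unfolding Q_def using f_im f_inj by (metis inv_into_image_cancel order_refl)
  have only: "m = i" if "i \<in> {1..r}" "m \<in> {1..r}" "choice_point c m \<in> Q i" for i m
    using that Q uniq[of "Q i" "Q m"] f_im
    unfolding Q_def by (metis f_inv_into_f)
  have Qinj: "i = m" if "i \<in> {1..r}" "m \<in> {1..r}" "y \<in> Q i" "y \<in> Q m" for i m y
    using that Q uniq only by metis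
  \<comment> \<open>For \<open>k\<close> in \<open>{1..r - 1}\<close> the choice is forced, since
    the sets \<open>Q i\<close> are disjoint and cover the axis points. The restriction in
    \<open>g\<close> fixes the values elsewhere.\<close>
  define h where "h j k = (SOME i. i \<in> {1..r} \<and> real k *\<^sub>R axis j 1 \<in> Q i)" for j k
  have "\<exists>i\<in>{1..r}. real k *\<^sub>R axis j 1 \<in> Q i" if "k \<in> {1..r - 1}" for j k
    using axis_multiple_mem[OF that, of j c] un QP by blast
  then have h: "h j k \<in> {1..r} \<and> real k *\<^sub>R axis j 1 \<in> Q (h j k)" if "k \<in> {1..r - 1}" for j k
    unfolding h_def using someI_ex[of "\<lambda>i. i \<in> {1..r} \<and> real k *\<^sub>R axis j 1 \<in> Q i"] that
    by blast
  define g where "g j = restrict (h j) {1..r - 1}" for j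
  have g: "g j k = i \<longleftrightarrow> real k *\<^sub>R axis j 1 \<in> Q i" if "k \<in> {1..r - 1}" "i \<in> {1..r}" for j k i
  proof -
    have "g j k = h j k" using that by (simp add: g_def)
    then show ?thesis
      using h[OF that(1), of j] that(2) Qinj[of "h j k" i "real k *\<^sub>R axis j 1"] by metis
  qed
  have sup: "{1..r} - {c j} \<subseteq> g j ` {1..r - 1}" for j
  proof
    fix i assume i: "i \<in> {1..r} - {c j}"
    obtain k where "k \<in> {1..r - 1}" "real k *\<^sub>R axis j 1 \<in> Q i"
      using zero_hull_axis_point[OF sub zero, of "Q i" i j] Q[of i] only[of i] i by auto
    then show "i \<in> g j ` {1..r - 1}" using g[of k i j] i by blast
  qed
  have cardc: "card ({1..r} - {c j}) = r - 1" for j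
    using c by (simp add: card_Diff_singleton_if image_subset_iff)
  \<comment> \<open>The image contains \<open>r - 1\<close> required indices but comes from only
    \<open>r - 1\<close> points, so nothing is left over: \<open>c j\<close> is not hit and no index
    is hit twice.\<close>
  have im: "g j ` {1..r - 1} = {1..r} - {c j}" for j
    using card_seteq[OF _ sup[of j]] card_image_le[of "{1..r - 1}" "g j"] cardc[of j] by simp
  have inj: "inj_on (g j) {1..r - 1}" for j
    by (rule eq_card_imp_inj_on) (use im[of j] cardc[of j] in simp_all)
  have "g j \<in> {1..r - 1} \<rightarrow>\<^sub>E {1..r} - {c j}" for j
    using im[of j] by (auto simp: PiE_def Pi_iff g_def simp del: atLeastAtMost_iff)
  then have "g \<in> assignments r c"
    using inj by (simp add: assignments_def PiE_UNIV_domain)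
  moreover have "assigned_part r c g i = Q i" if i: "i \<in> {1..r}" for i
  proof (intro set_eqI iffI)
    fix y assume "y \<in> assigned_part r c g i"
    then show "y \<in> Q i" using Q[OF i] g i by (auto simp: assigned_part_def)
  next
    fix y assume y: "y \<in> Q i"
    then have "y \<in> ?X" using Q(1)[OF i] sub by blast
    then show "y \<in> assigned_part r c g i"
    proof (cases rule: constructed_set_cases)
      case (choice m) then show ?thesis using only[OF i] y by (auto simp: assigned_part_def)
    next
      case (axis j k) then show ?thesis using g i y by (simp add: axis_multiple_assigned_part)
    qed
  qed
  then have "P = assigned_part r c g ` {1..r}" using QP by auto
  ultimately show ?thesis by blast
qed

theorem proposition3p4:
  fixes r n :: nat
    and a :: "nat \<Rightarrow> int"
    and c :: "'d::finite \<Rightarrow> nat"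
    and X :: "(real ^ 'd) set"
  assumes "r \<ge> 1"
    and "n = (CARD('d) + 1) * (r - 1) + 1"
    and "\<And>i. i \<in> {1..r} \<Longrightarrow> a i \<le> int CARD('d) + 1"
    and "(\<Sum>i = 1..r. a i) = int n"
    and "admissible_choice r a c"
    and "X = constructed_set r c"
  shows "card {P. tverberg_partition r X P} = fact (r - 1) ^ CARD('d)"
proof -
  have c: "range c \<subseteq> {1..r}" using assms(5) by (auto simp: admissible_choice_def)
  \<comment> \<open>Soundness and completeness of the construction give the two inclusions;
    injectivity then transfers the count.\<close>
  have "{P. tverberg_partition r X P} = (\<lambda>g. assigned_part r c g ` {1..r}) ` assignments r c"
    using tverberg_partition_assigned_part[OF assms(1) c] tverberg_partition_assigned[OF assms(1) c]
    unfolding assms(6) by blast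
  then show ?thesis
    by (simp only: card_image[OF inj_on_assignments[OF c]] card_assignments[OF c])
qed

end
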